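(* Let $(X,d)$ be a compact, totally disconnected metric space. Then there exists a dendrite $(Y,\rho)$ such that its endpoint set $E(Y)$, with the metric restricted from $\rho$, is isometric to $(X,d)$ (that is, there is a distance-preserving bijection $X\to E(Y)$); in particular $E(Y)$ is necessarily closed in $Y$.
   Context: A topological space is totally disconnected if its only nonempty connected subsets are singletons. A continuum is a compact connected metric space. A dendrite is a locally connected continuum containing no subspace homeomorphic to the circle; it always comes equipped with a metric. The degenerate cases, the empty space and the one-point space, are counted as dendrites. The endpoint set of a dendrite $Y$ is $E(Y)=\{y\in Y : Y\setminus\{y\}\text{ is connected}\}$, where the empty set is considered connected (so a one-point dendrite has its point as an endpoint). *)

theory Defs
  imports "HOL-Analysis.Analysis"
begin

text \<open>A metric space is given by a carrier set and a distance function satisfying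
  the library predicate \<open>Metric_space\<close>; its topology is \<open>Metric_space.mtopology\<close>.
  The empty space is allowed and is compact and connected in the library's sense.\<close>

definition totally_disconnected_space :: "'a topology \<Rightarrow> bool" where
  "totally_disconnected_space T \<longleftrightarrow>
     (\<forall>S. connectedin T S \<and> S \<noteq> {} \<longrightarrow> (\<exists>x. S = {x}))"

definition continuum :: "'a set \<Rightarrow> ('a \<Rightarrow> 'a \<Rightarrow> real) \<Rightarrow> bool" where
  "continuum Y \<rho> \<longleftrightarrow>
     Metric_space Y \<rho> \<and>
     compact_space (Metric_space.mtopology Y \<rho>) \<and>
     connected_space (Metric_space.mtopology Y \<rho>)"

definition dendrite :: "'a set \<Rightarrow> ('a \<Rightarrow> 'a \<Rightarrow> real) \<Rightarrow> bool" where
  "dendrite Y \<rho> \<longleftrightarrow>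
     continuum Y \<rho> \<and>
     locally_connected_space (Metric_space.mtopology Y \<rho>) \<and>
     \<not> (\<exists>S\<subseteq>Y. subtopology (Metric_space.mtopology Y \<rho>) S
                homeomorphic_space top_of_set (sphere (0::complex) 1))"

text \<open>For \<open>Y = {y}\<close> the complement \<open>Y - {y}\<close> is empty, hence connected, so \<open>y\<close> is an endpoint.\<close>

definition endpoints :: "'a set \<Rightarrow> ('a \<Rightarrow> 'a \<Rightarrow> real) \<Rightarrow> 'a set" where
  "endpoints Y \<rho> = {y \<in> Y. connectedin (Metric_space.mtopology Y \<rho>) (Y - {y})}"

text \<open>Since \<open>\<rho>\<close> is a function on the whole type, restricting a metric to a subset only
  changes the carrier.\<close>

definition isometric :: "'a set \<Rightarrow> ('a \<Rightarrow> 'a \<Rightarrow> real) \<Rightarrow> 'b set \<Rightarrow> ('b \<Rightarrow> 'b \<Rightarrow> real) \<Rightarrow> bool" where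
  "isometric X d Z \<rho> \<longleftrightarrow>
     (\<exists>f. bij_betw f X Z \<and> (\<forall>x\<in>X. \<forall>x'\<in>X. \<rho> (f x) (f x') = d x x'))"

text \<open>The existence of a dendrite is stated for subsets of \<^typ>\<open>real\<close>
  carrying an arbitrary metric (unrelated to the usual distance on \<^typ>\<open>real\<close>).
  A compact metric space has at most continuum many points, so up to isometry every
  compact metric space arises in this way.\<close>

end

theory Submission
  imports Defs
begin

text \<open>Nested partitions of \<open>X\<close> into small clopen sets give an ultrametric \<open>u \<ge> d\<close> inducing the same
  topology. Its dendrogram, \<open>X \<times> [0, r]\<close> with \<open>(x, s)\<close> and \<open>(y, s)\<close> identified when \<open>u x y \<le> s\<close> and
  \<open>r\<close> the diameter of \<open>u\<close>, is a compact real tree whose endpoints are the points of height 0: from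
  any point one can climb to the root, and every point of positive height separates the part below
  it from the rest. The path metric restricts to \<open>2 u \<ge> d\<close> on the endpoints, so the
  largest metric below it that is also below \<open>d\<close> there restricts to \<open>d\<close>; by compactness it induces
  the same topology.\<close>

subsection \<open>Dominating ultrametrics on totally disconnected spaces\<close>

text \<open>By the cut-wire-fence theorem, compactness and total disconnectedness put a clopen
  neighbourhood of each point inside any given ball around it. Finitely many of these cover
  \<open>M\<close>, and each point is labelled by the first one containing it.\<close>

lemma (in Metric_space) fine_locally_constant_labelling:
  assumes compact: "compact_space mtopology"
    and td: "totally_disconnected_space mtopology"
    and "\<epsilon> > 0"
  obtains l :: "'a \<Rightarrow> nat" where
    "\<And>x. x \<in> M \<Longrightarrow> \<exists>\<delta>>0. \<forall>y\<in>M. d x y < \<delta> \<longrightarrow> l y = l x"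
    "\<And>x y. \<lbrakk>x \<in> M; y \<in> M; l x = l y\<rbrakk> \<Longrightarrow> d x y < \<epsilon>"
proof -
  have "\<exists>U. closedin mtopology U \<and> openin mtopology U \<and> x \<in> U \<and> U \<subseteq> mball x (\<epsilon>/2)"
    if x: "x \<in> M" for x
  proof -
    have "separated_between mtopology {x} (M - mball x (\<epsilon>/2))"
    proof (rule cut_wire_fence_theorem[OF compact Hausdorff_space_mtopology])
      show "closedin mtopology {x}"
        using x by (simp add: closedin_Hausdorff_sing_eq Hausdorff_space_mtopology)
      show "closedin mtopology (M - mball x (\<epsilon>/2))"
        by (metis closedin_diff closedin_mspace openin_mball)
      show "disjnt C {x} \<or> disjnt C (M - mball x (\<epsilon>/2))" if "connectedin mtopology C" for C
      proof (cases "x \<in> C")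
        case True
        then have "C = {x}"
          using td that unfolding totally_disconnected_space_def by blast
        then show ?thesis
          using x \<open>\<epsilon> > 0\<close> by (auto simp: disjnt_def)
      qed (auto simp: disjnt_def)
    qed
    then obtain U where "closedin mtopology U" "openin mtopology U" "{x} \<subseteq> U"
      and "M - mball x (\<epsilon>/2) \<subseteq> topspace mtopology - U"
      unfolding separated_between by blast
    moreover have "U \<subseteq> M"
      using \<open>openin mtopology U\<close> openin_subset by fastforce
    ultimately show ?thesis
      by auto
  qed
  then obtain U where U: "\<And>x. x \<in> M \<Longrightarrow> closedin mtopology (U x)"
      "\<And>x. x \<in> M \<Longrightarrow> openin mtopology (U x)" "\<And>x. x \<in> M \<Longrightarrow> x \<in> U x"
      "\<And>x. x \<in> M \<Longrightarrow> U x \<subseteq> mball x (\<epsilon>/2)"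
    by metis
  have "M \<subseteq> \<Union>(U ` M)"
    using U(3) by blast
  then obtain \<F> where \<F>: "finite \<F>" "\<F> \<subseteq> U ` M" "M \<subseteq> \<Union>\<F>"
    using compact[unfolded compact_space_alt, rule_format, of "U ` M"] U(2) by auto
  obtain xs where xs: "set xs = \<F>"
    using finite_list[OF \<F>(1)] by blast
  define l where "l x = (LEAST j. j < length xs \<and> x \<in> xs ! j)" for x
  have cover: "l x < length xs \<and> x \<in> xs ! l x" if "x \<in> M" for x
  proof -
    have "\<exists>j. j < length xs \<and> x \<in> xs ! j"
      using that \<F>(3) xs by (metis Union_iff in_set_conv_nth subsetD)
    then show ?thesis
      unfolding l_def by (rule LeastI_ex)
  qed
  have clopen: "openin mtopology (xs ! j)" "closedin mtopology (xs ! j)" if "j < length xs" for j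
    using that xs \<F>(2) U(1,2) by (metis imageE nth_mem subsetD)+
  show thesis
  proof
    fix x assume x: "x \<in> M"
    \<comment> \<open>Points of this intersection lie in exactly the same cover members as
      \<open>x\<close>, so the label is constant there; finiteness of the cover makes it
      open.\<close>
    let ?W = "\<Inter>j<length xs. (if x \<in> xs ! j then xs ! j else M - xs ! j)"
    have "openin mtopology (M \<inter> ?W)"
      using clopen by (intro openin_Int_Inter) (auto intro: openin_diff)
    moreover have "x \<in> M \<inter> ?W"
      using x by auto
    ultimately obtain \<delta> where \<delta>: "\<delta> > 0" "mball x \<delta> \<subseteq> M \<inter> ?W"
      unfolding openin_mtopology by blast
    have "l y = l x" if "y \<in> M" "d x y < \<delta>" for y
    proof -
      have "y \<in> mball x \<delta>"
        using x that by simp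
      then have "y \<in> ?W"
        using \<delta>(2) by blast
      have "x \<in> xs ! j \<longleftrightarrow> y \<in> xs ! j" if "j < length xs" for j
      proof -
        have "y \<in> (if x \<in> xs ! j then xs ! j else M - xs ! j)"
          using \<open>y \<in> ?W\<close> that by blast
        then show ?thesis
          by (simp split: if_splits)
      qed
      then have "(\<lambda>j. j < length xs \<and> y \<in> xs ! j) = (\<lambda>j. j < length xs \<and> x \<in> xs ! j)"
        by blast
      then show ?thesis
        unfolding l_def by simp
    qed
    then show "\<exists>\<delta>>0. \<forall>y\<in>M. d x y < \<delta> \<longrightarrow> l y = l x"
      using \<delta>(1) by blast
  next
    fix x y assume xy: "x \<in> M" "y \<in> M" "l x = l y"
    have "x \<in> xs ! l x" "y \<in> xs ! l x" "xs ! l x \<in> \<F>"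
      using cover[OF xy(1)] cover[OF xy(2)] xy(3) xs by auto
    then obtain z where "z \<in> M" "x \<in> U z" "y \<in> U z"
      using \<F>(2) by blast
    then have "d z x < \<epsilon>/2" "d z y < \<epsilon>/2"
      using U(4) by fastforce+
    then show "d x y < \<epsilon>"
      using triangle[of x z y] xy \<open>z \<in> M\<close> commute[of x z] by linarith
  qed
qed

text \<open>Lets points of the dendrogram, described by a height and a set of pairs of naturals, be
  real numbers, as the theorem demands of the carrier. Through a bijection between reals and sets of
  naturals, even numbers carry the height and odd numbers the set, so both can be read off.\<close>

lemma real_nat_set_encoding:
  obtains code :: "real \<Rightarrow> (nat \<times> nat) set \<Rightarrow> real"
    where "\<And>s A t B. code s A = code t B \<longleftrightarrow> s = t \<and> A = B"
proof -
  obtain f :: "nat set \<Rightarrow> real" where f: "bij f"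
    using nat_sets_eqpoll_reals unfolding eqpoll_def by auto
  define code where
    "code s A = f ((\<lambda>i. 2 * i) ` inv f s \<union> (\<lambda>p. Suc (2 * prod_encode p)) ` A)" for s A
  have "s = t \<and> A = B" if "code s A = code t B" for s t :: real and A B
  proof -
    have eq: "(\<lambda>i. 2 * i) ` inv f s \<union> (\<lambda>p. Suc (2 * prod_encode p)) ` A
            = (\<lambda>i. 2 * i) ` inv f t \<union> (\<lambda>p. Suc (2 * prod_encode p)) ` B" (is "?L = ?R")
      using that f unfolding code_def by (meson bij_is_inj injD)
    have "i \<in> inv f s \<longleftrightarrow> i \<in> inv f t" for i
    proof -
      have "i \<in> inv f s \<longleftrightarrow> 2 * i \<in> ?L" "i \<in> inv f t \<longleftrightarrow> 2 * i \<in> ?R"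
        by (auto simp: image_iff; presburger)+
      then show ?thesis using eq by simp
    qed
    then have "inv f s = inv f t" by blast
    moreover have "p \<in> A \<longleftrightarrow> p \<in> B" for p
    proof -
      have "p \<in> A \<longleftrightarrow> Suc (2 * prod_encode p) \<in> ?L" "p \<in> B \<longleftrightarrow> Suc (2 * prod_encode p) \<in> ?R"
        by (auto simp: image_iff; presburger)+
      then show ?thesis using eq by simp
    qed
    ultimately show ?thesis
      using f by (metis bij_is_surj subsetI subset_antisym surj_f_inv_f)
  qed
  then have "\<And>s A t B. code s A = code t B \<longleftrightarrow> s = t \<and> A = B"
    by blast
  then show thesis by (rule that)
qed

text \<open>\<open>c x s\<close> codes the point at height \<open>s\<close> above \<open>x\<close> in the dendrogram of \<open>u\<close> as a real number:
  it records \<open>s\<close> and the labels of \<open>x\<close> at all scales coarser than \<open>s\<close>.\<close>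

lemma (in Metric_space) dominating_ultrametric:
  assumes compact: "compact_space mtopology"
    and td: "totally_disconnected_space mtopology"
  obtains u :: "'a \<Rightarrow> 'a \<Rightarrow> real" and c :: "'a \<Rightarrow> real \<Rightarrow> real" and r :: real
  where "Metric_space M u"
    "\<And>x y z. \<lbrakk>x \<in> M; y \<in> M; z \<in> M\<rbrakk> \<Longrightarrow> u x z \<le> max (u x y) (u y z)"
    "\<And>x y. \<lbrakk>x \<in> M; y \<in> M\<rbrakk> \<Longrightarrow> d x y \<le> u x y"
    "compact_space (Metric_space.mtopology M u)"
    "r \<ge> 0"
    "\<And>x y. \<lbrakk>x \<in> M; y \<in> M\<rbrakk> \<Longrightarrow> u x y \<le> r"
    "\<And>x. x \<in> M \<Longrightarrow> \<exists>y\<in>M. u x y = r"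
    "\<And>x y s t. \<lbrakk>x \<in> M; y \<in> M; s \<ge> 0; t \<ge> 0\<rbrakk> \<Longrightarrow> c x s = c y t \<longleftrightarrow> s = t \<and> u x y \<le> t"
proof -
  have "\<exists>K>0. \<forall>x\<in>M. \<forall>y\<in>M. d x y \<le> K"
    using compact compactin_imp_mbounded[of M]
    unfolding compact_space_def mbounded_alt_pos by auto
  then obtain K where K: "K > 0" "\<And>x y. \<lbrakk>x \<in> M; y \<in> M\<rbrakk> \<Longrightarrow> d x y \<le> K"
    by blast
  \<comment> \<open>The scales start at \<open>K\<close>, so that \<open>w 0\<close> dominates
    \<open>d\<close> even for points whose labels differ already at level 0.\<close>
  define w where "w n = K / 2 ^ n" for n
  have w_pos: "w n > 0" for n
    using K(1) by (simp add: w_def)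
  have w_less: "w n < w m \<longleftrightarrow> m < n" for m n
    using K(1) by (simp add: w_def field_simps)
  then have w_le: "w n \<le> w m \<longleftrightarrow> m \<le> n" for m n
    by (meson linorder_not_less)
  have w_null: "\<exists>N. w N < e" if "e > 0" for e
  proof -
    have "w \<longlonglongrightarrow> 0"
      unfolding w_def by (rule LIMSEQ_divide_realpow_zero) simp
    then show ?thesis
      using that by (metis LIMSEQ_D diff_zero le_refl real_norm_def abs_of_pos w_pos)
  qed
  \<comment> \<open>The shift to \<open>w (Suc n)\<close> matters: points first told apart at level
    \<open>Suc n\<close> still agree at level \<open>n\<close>, so \<open>d\<close> is below
    \<open>w (Suc n)\<close>, which will be their \<open>u\<close>-distance.\<close>
  have "\<exists>l::'a \<Rightarrow> nat. (\<forall>x\<in>M. \<exists>\<delta>>0. \<forall>y\<in>M. d x y < \<delta> \<longrightarrow> l y = l x) \<and>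
      (\<forall>x\<in>M. \<forall>y\<in>M. l x = l y \<longrightarrow> d x y < w (Suc n))" for n
    using fine_locally_constant_labelling[OF compact td w_pos] by metis
  then obtain l :: "nat \<Rightarrow> 'a \<Rightarrow> nat" where
      l_const: "\<And>n x. x \<in> M \<Longrightarrow> \<exists>\<delta>>0. \<forall>y\<in>M. d x y < \<delta> \<longrightarrow> l n y = l n x"
    and l_fine: "\<And>n x y. \<lbrakk>x \<in> M; y \<in> M; l n x = l n y\<rbrakk> \<Longrightarrow> d x y < w (Suc n)"
    by metis
  \<comment> \<open>The labellings at different levels need not refine one another. Recording only
    the first disagreement replaces them by the nested partitions according to all labels up to a
    given level.\<close>
  define N where "N x y = (LEAST n. l n x \<noteq> l n y)" for x y
  define u where "u x y = (if x = y then 0 else w (N x y))" for x y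
  have N_sep: "l (N x y) x \<noteq> l (N x y) y" if xy: "x \<in> M" "y \<in> M" "x \<noteq> y" for x y
  proof -
    have "\<exists>n. l n x \<noteq> l n y"
    proof (rule ccontr)
      assume "\<nexists>n. l n x \<noteq> l n y"
      then have "d x y < w (Suc n)" for n
        using l_fine xy by blast
      moreover obtain n where "w n < d x y"
        using w_null[of "d x y"] xy by auto
      ultimately show False
        using w_le[of "Suc n" n] by (meson le_SucI order_refl less_asym order_le_less_trans)
    qed
    then show ?thesis
      unfolding N_def by (rule LeastI_ex)
  qed
  have N_least: "l n x = l n y" if "n < N x y" for n x y
    using that not_less_Least unfolding N_def by blast
  \<comment> \<open>Being within \<open>t\<close> means agreeing at all scales coarser than
    \<open>t\<close>, which is an equivalence relation. The ultrametric inequality thus becomes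
    transitivity, and the same condition will decide when two codes are equal.\<close>
  have u_le: "u x y \<le> t \<longleftrightarrow> (\<forall>n. w n > t \<longrightarrow> l n x = l n y)"
    if xy: "x \<in> M" "y \<in> M" "t \<ge> 0" for x y t
  proof (cases "x = y")
    case False
    have "w (N x y) \<le> t \<longleftrightarrow> (\<forall>n. w n > t \<longrightarrow> l n x = l n y)"
      using N_sep[OF xy(1,2) False] N_least w_less
      by (meson linorder_not_less order_less_le_trans)
    then show ?thesis
      using False by (simp add: u_def)
  qed (use xy in \<open>simp add: u_def\<close>)
  have u_nonneg: "u x y \<ge> 0" for x y
    using w_pos by (simp add: u_def less_imp_le)
  have u_comm: "u x y = u y x" for x y
    by (simp add: u_def N_def eq_commute)
  have ultra: "u x z \<le> max (u x y) (u y z)" if "x \<in> M" "y \<in> M" "z \<in> M" for x y z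
  proof -
    let ?m = "max (u x y) (u y z)"
    have m: "?m \<ge> 0" "u x y \<le> ?m" "u y z \<le> ?m"
      using u_nonneg by (auto simp: le_max_iff_disj)
    then show ?thesis
      using that by (auto simp: u_le simp del: max.bounded_iff max.cobounded1 max.cobounded2)
  qed
  have metric: "Metric_space M u"
  proof
    show "u x y = 0 \<longleftrightarrow> x = y" for x y
      using w_pos by (metis less_irrefl u_def)
    show "u x z \<le> u x y + u y z" if "x \<in> M" "y \<in> M" "z \<in> M" for x y z
      using ultra[OF that] u_nonneg[of x y] u_nonneg[of y z] by linarith
  qed (use u_nonneg u_comm in auto)
  have dom: "d x y \<le> u x y" if xy: "x \<in> M" "y \<in> M" for x y
  proof (cases "x = y")
    case False
    show ?thesis
    proof (cases "N x y")
      case 0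
      then show ?thesis
        using K(2)[OF xy] False by (simp add: u_def w_def)
    next
      case (Suc n)
      then have "d x y < w (N x y)"
        using l_fine[OF xy, of n] N_least[of n x y] by simp
      then show ?thesis
        using False by (simp add: u_def)
    qed
  qed (use xy in \<open>simp add: u_def\<close>)
  interpret U: Metric_space M u by (fact metric)
  \<comment> \<open>Local constancy of the labels makes the identity continuous from
    \<open>d\<close> to \<open>u\<close>, which transfers compactness.\<close>
  have cont: "continuous_map mtopology U.mtopology id"
    unfolding U.continuous_map_to_metric
  proof (intro ballI allI impI)
    fix x and \<epsilon> :: real assume x: "x \<in> topspace mtopology" and "\<epsilon> > 0"
    obtain m where m: "w m < \<epsilon>"
      using w_null[OF \<open>\<epsilon> > 0\<close>] by blast
    obtain \<delta> where \<delta>: "\<And>n. \<delta> n > 0" "\<And>n y. y \<in> M \<Longrightarrow> d x y < \<delta> n \<Longrightarrow> l n y = l n x"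
      using l_const x by (metis topspace_mtopology)
    \<comment> \<open>Only the levels below \<open>m\<close> decide \<open>u x y \<le> w m\<close>;
      including \<open>m\<close> itself keeps the set nonempty for \<open>Min\<close>.\<close>
    define \<delta>' where "\<delta>' = Min (\<delta> ` {..m})"
    have "\<delta>' > 0"
      using \<delta>(1) by (simp add: \<delta>'_def)
    have "u x y \<le> w m" if y: "y \<in> mball x \<delta>'" for y
    proof -
      have "l n x = l n y" if "w n > w m" for n
      proof -
        have "\<delta>' \<le> \<delta> n"
          using that by (auto simp: \<delta>'_def w_less)
        then show ?thesis
          using \<delta>(2) y by force
      qed
      then show ?thesis
        using u_le x y w_pos by (simp add: less_imp_le)
    qed
    then show "\<exists>U. openin mtopology U \<and> x \<in> U \<and> (\<forall>y\<in>U. id y \<in> U.mball (id x) \<epsilon>)"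
      using m x \<open>\<delta>' > 0\<close>
      by (intro exI[of _ "mball x \<delta>'"]) force
  qed
  have cpt: "compact_space U.mtopology"
    using image_compactin[OF _ cont, of M] compact by (simp add: compact_space_def)
  obtain r where r: "r \<ge> 0" "\<And>x y. \<lbrakk>x \<in> M; y \<in> M\<rbrakk> \<Longrightarrow> u x y \<le> r"
    "\<And>x. x \<in> M \<Longrightarrow> \<exists>y\<in>M. u x y = r"
  proof (cases "\<exists>x\<in>M. \<exists>y\<in>M. x \<noteq> y")
    case False
    then show ?thesis
      using that[of 0] by (auto simp: u_def)
  next
    case True
    \<comment> \<open>Larger distances belong to earlier levels, so a pair separated at the least
      occurring level realizes the diameter.\<close>
    define P where "P n \<longleftrightarrow> (\<exists>x\<in>M. \<exists>y\<in>M. x \<noteq> y \<and> N x y = n)" for n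
    have "Ex P"
      using True unfolding P_def by blast
    then have "P (LEAST n. P n)"
      by (rule LeastI_ex)
    then obtain a b where ab: "a \<in> M" "b \<in> M" "a \<noteq> b" and least: "N a b = (LEAST n. P n)"
      unfolding P_def by auto
    have bound: "u x y \<le> u a b" if "x \<in> M" "y \<in> M" for x y
    proof (cases "x = y")
      case False
      then have "N a b \<le> N x y"
        unfolding least using that by (intro Least_le) (auto simp: P_def)
      then show ?thesis
        using False ab by (simp add: u_def w_le)
    qed (use u_nonneg[of a b] in \<open>simp add: u_def\<close>)
    \<comment> \<open>If both \<open>u x a\<close> and \<open>u x b\<close> were below the maximal
      value \<open>u a b\<close>, the ultrametric inequality through \<open>x\<close> would
      fail.\<close>
    moreover have "\<exists>y\<in>M. u x y = u a b" if "x \<in> M" for x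
      using ultra[OF ab(1) that ab(2)] bound[OF that] ab u_comm[of a x]
      by (metis antisym le_max_iff_disj)
    ultimately show ?thesis
      using that[of "u a b"] u_nonneg by blast
  qed
  obtain code :: "real \<Rightarrow> (nat \<times> nat) set \<Rightarrow> real"
    where code: "\<And>s A t B. code s A = code t B \<longleftrightarrow> s = t \<and> A = B"
    using real_nat_set_encoding by metis
  define c where "c x t = code t {(n, l n x) | n. w n > t}" for x t
  have code_eq: "c x s = c y t \<longleftrightarrow> s = t \<and> u x y \<le> t" if "x \<in> M" "y \<in> M" "s \<ge> 0" "t \<ge> 0" for x y s t
    unfolding c_def code using u_le[OF that(1,2,4)] by auto
  show thesis
    by (rule that[OF metric ultra dom cpt r code_eq])
qed

subsection \<open>Extending a metric from a subset\<close>

text \<open>The smaller metric has the coarser topology, and a compact topology has no strictly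
  coarser Hausdorff topology.\<close>

lemma Metric_space_mtopology_eqI:
  assumes "Metric_space Y \<tau>" "Metric_space Y \<rho>"
    and compact: "compact_space (Metric_space.mtopology Y \<tau>)"
    and le: "\<And>p q. \<lbrakk>p \<in> Y; q \<in> Y\<rbrakk> \<Longrightarrow> \<rho> p q \<le> \<tau> p q"
  shows "Metric_space.mtopology Y \<rho> = Metric_space.mtopology Y \<tau>"
proof -
  interpret T: Metric_space Y \<tau> by fact
  interpret R: Metric_space Y \<rho> by fact
  have ball: "T.mball p e \<subseteq> R.mball p e" for p e
    using le by fastforce
  have "openin T.mtopology U" if "openin R.mtopology U" for U
    using that ball unfolding R.openin_mtopology T.openin_mtopology by (meson order_trans)
  then have "T.mtopology = R.mtopology"
    by (intro compact_Hausdorff_space_optimal) (use compact R.Hausdorff_space_mtopology in auto)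
  then show ?thesis ..
qed

text \<open>Take the infimum over routes that are direct or make one jump inside the image of
  \<open>X\<close>, charged at its \<open>d\<close>-length. Since \<open>\<tau>\<close> dominates
  \<open>d\<close> on the image, no route undercuts \<open>d\<close> there, while \<open>far\<close>
  prevents a point off the image from collapsing onto another point.\<close>

lemma extend_smaller_metric:
  assumes "Metric_space Y \<tau>" "Metric_space X d"
    and e: "e \<in> X \<rightarrow> Y"
    and le: "\<And>x y. \<lbrakk>x \<in> X; y \<in> X\<rbrakk> \<Longrightarrow> d x y \<le> \<tau> (e x) (e y)"
    and far: "\<And>p. p \<in> Y - e ` X \<Longrightarrow> \<exists>\<delta>>0. \<forall>x\<in>X. \<tau> p (e x) \<ge> \<delta>"
  obtains \<rho> where "Metric_space Y \<rho>"
    "\<And>p q. \<lbrakk>p \<in> Y; q \<in> Y\<rbrakk> \<Longrightarrow> \<rho> p q \<le> \<tau> p q"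
    "\<And>x y. \<lbrakk>x \<in> X; y \<in> X\<rbrakk> \<Longrightarrow> \<rho> (e x) (e y) = d x y"
proof -
  interpret T: Metric_space Y \<tau> by fact
  interpret D: Metric_space X d by fact
  define S where "S p q = insert (\<tau> p q) {\<tau> p (e x) + d x y + \<tau> (e y) q | x y. x \<in> X \<and> y \<in> X}"
    for p q
  define \<rho> where "\<rho> p q = Inf (S p q)" for p q
  have S_nonneg: "0 \<le> a" if "a \<in> S p q" for a p q
    using that unfolding S_def by auto
  have S_cases: "a = \<tau> p q \<or> (\<exists>x\<in>X. \<exists>y\<in>X. a = \<tau> p (e x) + d x y + \<tau> (e y) q)" if "a \<in> S p q" for a p q
    using that unfolding S_def by auto
  have S_ne: "S p q \<noteq> {}" for p q
    by (simp add: S_def)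
  have S_bdd: "bdd_below (S p q)" for p q
    using S_nonneg by (rule bdd_belowI)
  have \<rho>_le: "\<rho> p q \<le> a" if "a \<in> S p q" for a p q
    unfolding \<rho>_def using that S_bdd by (rule cInf_lower)
  have \<rho>_ge: "b \<le> \<rho> p q" if "\<And>a. a \<in> S p q \<Longrightarrow> b \<le> a" for b p q
    unfolding \<rho>_def using S_ne that by (rule cInf_greatest)
  have eY: "e x \<in> Y" if "x \<in> X" for x
    using e that by auto
  have le_\<tau>: "\<rho> p q \<le> \<tau> p q" for p q
    by (rule \<rho>_le) (simp add: S_def)
  have eq: "\<rho> (e x) (e y) = d x y" if x: "x \<in> X" and y: "y \<in> X" for x y
  proof (rule antisym)
    have "\<tau> (e x) (e x) + d x y + \<tau> (e y) (e y) \<in> S (e x) (e y)"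
      using x y unfolding S_def by blast
    then show "\<rho> (e x) (e y) \<le> d x y"
      using \<rho>_le x y eY by fastforce
    show "d x y \<le> \<rho> (e x) (e y)"
    proof (rule \<rho>_ge)
      fix a assume "a \<in> S (e x) (e y)"
      then consider "a = \<tau> (e x) (e y)" | x' y' where "x' \<in> X" "y' \<in> X"
          "a = \<tau> (e x) (e x') + d x' y' + \<tau> (e y') (e y)"
        using S_cases by blast
      then show "d x y \<le> a"
      proof cases
        case 2
        then show ?thesis
          using le[of x x'] le[of y' y] D.triangle[of x x' y] D.triangle[of x' y' y] x y by auto
      qed (use le x y in auto)
    qed
  qed
  \<comment> \<open>Two routes in succession can be replaced by an allowed route that is no longer.
    The cases distinguish which of the two contain a jump.\<close>
  have triangle: "\<exists>c\<in>S p r. c \<le> a + b"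
    if pqr: "p \<in> Y" "q \<in> Y" "r \<in> Y" and a: "a \<in> S p q" and b: "b \<in> S q r" for p q r a b
  proof -
    note tri = T.triangle
    consider "a = \<tau> p q" "b = \<tau> q r"
      | x y where "x \<in> X" "y \<in> X" "a = \<tau> p q" "b = \<tau> q (e x) + d x y + \<tau> (e y) r"
      | x y where "x \<in> X" "y \<in> X" "a = \<tau> p (e x) + d x y + \<tau> (e y) q" "b = \<tau> q r"
      | x y x' y' where "x \<in> X" "y \<in> X" "x' \<in> X" "y' \<in> X"
          "a = \<tau> p (e x) + d x y + \<tau> (e y) q" "b = \<tau> q (e x') + d x' y' + \<tau> (e y') r"
      using S_cases[OF a] S_cases[OF b] by blast
    then show ?thesis
    proof cases
      case 1
      then show ?thesis
        using tri[of p q r] pqr by (auto simp: S_def)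
    next
      case 2
      then have "\<tau> p (e x) + d x y + \<tau> (e y) r \<in> S p r"
        unfolding S_def by blast
      moreover have "\<tau> p (e x) + d x y + \<tau> (e y) r \<le> a + b"
        using 2 tri[of p q "e x"] eY pqr by simp
      ultimately show ?thesis
        by blast
    next
      case 3
      then have "\<tau> p (e x) + d x y + \<tau> (e y) r \<in> S p r"
        unfolding S_def by blast
      moreover have "\<tau> p (e x) + d x y + \<tau> (e y) r \<le> a + b"
        using 3 tri[of "e y" q r] eY pqr by simp
      ultimately show ?thesis
        by blast
    next
      case 4
      then have "\<tau> p (e x) + d x y' + \<tau> (e y') r \<in> S p r"
        unfolding S_def by blast
      \<comment> \<open>Two jumps merge into one: by domination, the stretch between them is at
        least as long as \<open>d y x'\<close>.\<close>
      moreover have "d x y' \<le> d x y + (\<tau> (e y) q + \<tau> q (e x')) + d x' y'"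
        using 4 tri[of "e y" q "e x'"] le[of y x'] eY pqr
          D.triangle[of x y y'] D.triangle[of y x' y'] by simp
      then have "\<tau> p (e x) + d x y' + \<tau> (e y') r \<le> a + b"
        using 4 by simp
      ultimately show ?thesis
        by blast
    qed
  qed
  have S_swap: "S p q \<subseteq> S q p" for p q
  proof
    fix a assume "a \<in> S p q"
    then consider "a = \<tau> p q" | x y where "x \<in> X" "y \<in> X" "a = \<tau> p (e x) + d x y + \<tau> (e y) q"
      using S_cases by blast
    then show "a \<in> S q p"
    proof cases
      case 2
      then have "a = \<tau> q (e y) + d y x + \<tau> (e x) p"
        using T.commute D.commute by simp
      then show ?thesis
        using 2 unfolding S_def by blast
    qed (simp add: S_def T.commute)
  qed
  have pos: "p = q" if pq: "p \<in> Y" "q \<in> Y" and zero: "\<rho> p q = 0" for p q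
  proof (rule ccontr)
    assume "p \<noteq> q"
    have off_X: "\<rho> p' q' > 0" if "p' \<in> Y" "q' \<in> Y" "p' \<noteq> q'" "p' \<notin> e ` X" for p' q'
    proof -
      obtain \<delta> where \<delta>: "\<delta> > 0" "\<And>x. x \<in> X \<Longrightarrow> \<tau> p' (e x) \<ge> \<delta>"
        using far[of p'] \<open>p' \<in> Y\<close> \<open>p' \<notin> e ` X\<close> by blast
      \<comment> \<open>A route from \<open>p'\<close> is either direct or has to cover at least
        \<open>\<delta>\<close> before it reaches the image.\<close>
      have "min \<delta> (\<tau> p' q') \<le> \<rho> p' q'"
      proof (rule \<rho>_ge)
        fix a assume "a \<in> S p' q'"
        then consider "a = \<tau> p' q'"
          | x y where "x \<in> X" "y \<in> X" "a = \<tau> p' (e x) + d x y + \<tau> (e y) q'"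
          using S_cases by blast
        then show "min \<delta> (\<tau> p' q') \<le> a"
        proof cases
          case 2
          then show ?thesis
            using \<delta>(2)[of x] D.nonneg[of x y] T.nonneg[of "e y" q'] by linarith
        qed simp
      qed
      moreover have "\<tau> p' q' > 0"
        using that by simp
      ultimately show ?thesis
        using \<delta>(1) by linarith
    qed
    have "\<rho> q p = \<rho> p q"
      using S_swap unfolding \<rho>_def by (metis subset_antisym)
    then have "p \<in> e ` X" "q \<in> e ` X"
      using off_X[of p q] off_X[of q p] pq \<open>p \<noteq> q\<close> zero by auto
    then show False
      using eq zero \<open>p \<noteq> q\<close> by auto
  qed
  have metric: "Metric_space Y \<rho>"
  proof
    show "0 \<le> \<rho> p q" for p q
      using \<rho>_ge S_nonneg .
    show "\<rho> p q = \<rho> q p" for p q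
      using S_swap unfolding \<rho>_def by (metis subset_antisym)
    show "\<rho> p q = 0 \<longleftrightarrow> p = q" if "p \<in> Y" "q \<in> Y" for p q
      using pos[OF that] le_\<tau>[of p p] \<rho>_ge[of p p 0] S_nonneg that by force
    show "\<rho> p r \<le> \<rho> p q + \<rho> q r" if "p \<in> Y" "q \<in> Y" "r \<in> Y" for p q r
    proof -
      have *: "\<rho> p r \<le> a + b" if "a \<in> S p q" "b \<in> S q r" for a b
        using triangle[OF \<open>p \<in> Y\<close> \<open>q \<in> Y\<close> \<open>r \<in> Y\<close> that] \<rho>_le by force
      have "\<rho> p r - a \<le> \<rho> q r" if "a \<in> S p q" for a
        using *[OF that] by (intro \<rho>_ge) (simp only: diff_le_eq add.commute)
      then have "\<rho> p r - \<rho> q r \<le> \<rho> p q"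
        by (intro \<rho>_ge) (simp only: diff_le_eq add.commute)
      then show ?thesis
        by simp
    qed
  qed
  show thesis
    by (rule that[OF metric le_\<tau> eq])
qed

subsection \<open>The dendrogram of a compact ultrametric space\<close>

text \<open>The map \<open>c\<close> stays abstract: \<open>c_eq_iff\<close> says that it realizes
  the quotient of \<open>X \<times> [0, r]\<close> inside \<open>'b\<close>. For
  \<open>r > 0\<close>, \<open>r_attained\<close> makes the root a cut point instead of an
  endpoint.\<close>

locale ultrametric_tree = Metric_space X u
  for X :: "'a set" and u :: "'a \<Rightarrow> 'a \<Rightarrow> real" +
  fixes r :: real and c :: "'a \<Rightarrow> real \<Rightarrow> 'b"
  assumes ultra: "\<lbrakk>x \<in> X; y \<in> X; z \<in> X\<rbrakk> \<Longrightarrow> u x z \<le> max (u x y) (u y z)"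
    and compact: "compact_space mtopology"
    and r_nonneg: "r \<ge> 0"
    and u_le_r: "\<lbrakk>x \<in> X; y \<in> X\<rbrakk> \<Longrightarrow> u x y \<le> r"
    and r_attained: "x \<in> X \<Longrightarrow> \<exists>y\<in>X. u x y = r"
    and c_eq_iff: "\<lbrakk>x \<in> X; y \<in> X; s \<ge> 0; t \<ge> 0\<rbrakk> \<Longrightarrow> c x s = c y t \<longleftrightarrow> s = t \<and> u x y \<le> t"
begin

definition tree :: "'b set" where
  "tree = (\<Union>x\<in>X. c x ` {0..r})"

definition base :: "'b \<Rightarrow> 'a" where
  "base p = (SOME x. x \<in> X \<and> (\<exists>s\<in>{0..r}. p = c x s))"

definition height :: "'b \<Rightarrow> real" where
  "height p = (SOME s. s \<in> {0..r} \<and> (\<exists>x\<in>X. p = c x s))"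

text \<open>The path from \<open>c x s\<close> to \<open>c y t\<close> climbs to the height where the two branches meet
  and descends again.\<close>

definition tdist :: "'b \<Rightarrow> 'b \<Rightarrow> real" where
  "tdist p q = 2 * max (u (base p) (base q)) (max (height p) (height q)) - height p - height q"

lemma c_in_tree: "\<lbrakk>x \<in> X; 0 \<le> s; s \<le> r\<rbrakk> \<Longrightarrow> c x s \<in> tree"
  unfolding tree_def by (intro UN_I imageI) auto

lemma treeE:
  assumes "p \<in> tree"
  obtains x s where "x \<in> X" "0 \<le> s" "s \<le> r" "p = c x s"
  using assms unfolding tree_def by auto

lemma base_c:
  assumes "x \<in> X" "0 \<le> s" "s \<le> r"
  shows "base (c x s) \<in> X" "u (base (c x s)) x \<le> s"
proof -
  have "base (c x s) \<in> X \<and> (\<exists>t\<in>{0..r}. c x s = c (base (c x s)) t)"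
    unfolding base_def by (rule someI[of _ x]) (use assms in auto)
  then show "base (c x s) \<in> X" "u (base (c x s)) x \<le> s"
    using assms c_eq_iff[of x "base (c x s)" s] commute by auto
qed

lemma height_c [simp]:
  assumes "x \<in> X" "0 \<le> s" "s \<le> r"
  shows "height (c x s) = s"
proof -
  have "height (c x s) \<in> {0..r} \<and> (\<exists>y\<in>X. c x s = c y (height (c x s)))"
    unfolding height_def by (rule someI[of _ s]) (use assms in auto)
  then show ?thesis
    using assms c_eq_iff by auto
qed

text \<open>Another representative of a point differs from the chosen one by at most the height, and
  by the ultrametric inequality this does not change the maximum with the heights. So
  \<open>tdist\<close> is independent of the choice made in \<open>base\<close>.\<close>

lemma tdist_c:
  assumes x: "x \<in> X" "0 \<le> s" "s \<le> r" and y: "y \<in> X" "0 \<le> t" "t \<le> r"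
  shows "tdist (c x s) (c y t) = 2 * max (u x y) (max s t) - s - t"
proof -
  define x' y' where "x' = base (c x s)" and "y' = base (c y t)"
  have x': "x' \<in> X" "u x' x \<le> s" "u x x' \<le> s" and y': "y' \<in> X" "u y' y \<le> t" "u y y' \<le> t"
    using base_c[OF x] base_c[OF y] commute by (auto simp: x'_def y'_def)
  have "u x' y' \<le> max (u x y) (max s t)"
    using ultra[of x' x y'] ultra[of x y y'] x y x' y' by auto
  moreover have "u x y \<le> max (u x' y') (max s t)"
    using ultra[of x x' y] ultra[of x' y' y] x y x' y' by auto
  ultimately have "max (u x' y') (max s t) = max (u x y) (max s t)"
    by auto
  then show ?thesis
    using x y by (simp add: tdist_def x'_def y'_def)
qed

lemma tdist_le:
  assumes "x \<in> X" "0 \<le> s" "s \<le> r" "y \<in> X" "0 \<le> t" "t \<le> r"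
  shows "tdist (c x s) (c y t) \<le> 2 * u x y + \<bar>s - t\<bar>"
  using nonneg[of x y] by (simp add: tdist_c assms max_def abs_if)

text \<open>Keeps a point of positive height away from all leaves, as the extension of the metric
  will require.\<close>

lemma tdist_ge_height: "p \<in> tree \<Longrightarrow> q \<in> tree \<Longrightarrow> height p - height q \<le> tdist p q"
  by (auto elim!: treeE simp: tdist_c)

sublocale T: Metric_space tree tdist
proof
  show "0 \<le> tdist p q" "tdist p q = tdist q p" for p q
    by (auto simp: tdist_def commute max.commute)
  show "tdist p q = 0 \<longleftrightarrow> p = q" if p: "p \<in> tree" and q: "q \<in> tree" for p q
  proof -
    obtain x s y t where xs: "x \<in> X" "0 \<le> s" "s \<le> r" "p = c x s"
      and yt: "y \<in> X" "0 \<le> t" "t \<le> r" "q = c y t"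
      using p q by (metis treeE)
    then show ?thesis
      by (auto simp: tdist_c c_eq_iff max_def split: if_splits)
  qed
  show "tdist p q' \<le> tdist p q + tdist q q'"
    if p: "p \<in> tree" and q: "q \<in> tree" and q': "q' \<in> tree" for p q q'
  proof -
    obtain x s y t z v where "x \<in> X" "0 \<le> s" "s \<le> r" "p = c x s"
      and "y \<in> X" "0 \<le> t" "t \<le> r" "q = c y t" and "z \<in> X" "0 \<le> v" "v \<le> r" "q' = c z v"
      using p q q' by (metis treeE)
    \<comment> \<open>The meeting height of the ends is at most the larger of the two other meeting
      heights, and the smaller of these is at least the height of the middle point.\<close>
    then show ?thesis
      using ultra[of x y z] by (auto simp: tdist_c max_def split: if_splits)
  qed
qed

section \<open>Compactness, connectedness and local connectedness of the tree\<close>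

lemma continuous_c:
  "continuous_map (prod_topology mtopology (top_of_set {0..r})) T.mtopology (\<lambda>(x, s). c x s)"
  unfolding T.continuous_map_to_metric
proof (intro ballI allI impI)
  fix p and \<epsilon> :: real
  assume "p \<in> topspace (prod_topology mtopology (top_of_set {0..r}))" and "\<epsilon> > 0"
  then obtain x s where p: "p = (x, s)" and xs: "x \<in> X" "0 \<le> s" "s \<le> r"
    by auto
  let ?U = "mball x (\<epsilon>/4) \<times> ({0..r} \<inter> ball s (\<epsilon>/2))"
  have "openin (prod_topology mtopology (top_of_set {0..r})) ?U"
    by (auto simp: openin_prod_Times_iff)
  moreover have "p \<in> ?U"
    using \<open>\<epsilon> > 0\<close> xs by (simp add: p)
  moreover have "c y t \<in> T.mball (c x s) \<epsilon>" if "(y, t) \<in> ?U" for y t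
  proof -
    have "tdist (c x s) (c y t) < \<epsilon>"
      using tdist_le[of x s y t] that xs by (auto simp: dist_real_def)
    then show ?thesis
      using that xs by (auto intro: c_in_tree)
  qed
  ultimately show "\<exists>U. openin (prod_topology mtopology (top_of_set {0..r})) U \<and> p \<in> U \<and>
      (\<forall>q\<in>U. (case q of (y, t) \<Rightarrow> c y t) \<in> T.mball (case p of (x, s) \<Rightarrow> c x s) \<epsilon>)"
    unfolding p by (intro exI[of _ ?U]) auto
qed

lemma compact_tree: "compact_space T.mtopology"
proof -
  have "compact_space (prod_topology mtopology (top_of_set {0..r}))"
    using compact by (simp add: compact_space_prod_topology compact_space_subtopology)
  then have "compactin T.mtopology ((\<lambda>(x, s). c x s) ` (X \<times> {0..r}))"
    using image_compactin[OF _ continuous_c, of "X \<times> {0..r}"] by (simp add: compact_space_def)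
  moreover have "(\<lambda>(x, s). c x s) ` (X \<times> {0..r}) = tree"
    unfolding tree_def by force
  ultimately show ?thesis
    by (simp add: compact_space_def)
qed

lemma connectedin_branch:
  assumes x: "x \<in> X" and "0 \<le> a" "b \<le> r"
  shows "connectedin T.mtopology (c x ` {a..b})"
proof -
  have "continuous_map (top_of_set {0..r}) T.mtopology ((\<lambda>(x, s). c x s) \<circ> (\<lambda>s. (x, s)))"
    using x by (intro continuous_map_compose[OF _ continuous_c]) (simp add: continuous_map_pairedI)
  moreover have "connectedin (top_of_set {0..r}) {a..b}"
    using assms by (auto simp: connectedin_subtopology)
  ultimately have "connectedin T.mtopology (((\<lambda>(x, s). c x s) \<circ> (\<lambda>s. (x, s))) ` {a..b})"
    by (rule connectedin_continuous_map_image)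
  then show ?thesis
    by (simp add: comp_def)
qed

text \<open>The branches over \<open>x\<close> and \<open>y\<close> have merged at height
  \<open>m\<close>, so the two ascending arcs share their top point.\<close>

lemma connectedin_path:
  assumes x: "x \<in> X" "0 \<le> s" "s \<le> m" and y: "y \<in> X" "0 \<le> t" "t \<le> m" and m: "u x y \<le> m" "m \<le> r"
  shows "connectedin T.mtopology (c x ` {s..m} \<union> c y ` {t..m})"
proof (rule connectedin_Un)
  have "c x m = c y m"
    using assms by (subst c_eq_iff) auto
  moreover have "c x m \<in> c x ` {s..m}" "c y m \<in> c y ` {t..m}"
    using x y by auto
  ultimately show "c x ` {s..m} \<inter> c y ` {t..m} \<noteq> {}"
    by (metis IntI empty_iff)
qed (use assms connectedin_branch in auto)

lemma connected_tree: "connected_space T.mtopology"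
  unfolding connected_space_subconnected
proof (intro ballI)
  fix p q assume "p \<in> topspace T.mtopology" "q \<in> topspace T.mtopology"
  then obtain x s y t where "x \<in> X" "0 \<le> s" "s \<le> r" "p = c x s"
    and "y \<in> X" "0 \<le> t" "t \<le> r" "q = c y t"
    by (metis treeE T.topspace_mtopology)
  then show "\<exists>S. connectedin T.mtopology S \<and> p \<in> S \<and> q \<in> S"
    by (intro exI[of _ "c x ` {s..r} \<union> c y ` {t..r}"])
       (auto intro: connectedin_path u_le_r)
qed

text \<open>The path from the centre of a ball to any of its points stays in the ball. This gives
  connectedness im kleinen at every point, which is equivalent to local connectedness.\<close>

lemma locally_connected_tree: "locally_connected_space T.mtopology"
  unfolding locally_connected_space_im_kleinen
proof (intro allI impI, elim conjE)
  fix V p assume "openin T.mtopology V" "p \<in> V"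
  then obtain \<epsilon> where "\<epsilon> > 0" and sub: "T.mball p \<epsilon> \<subseteq> V"
    unfolding T.openin_mtopology by blast
  have "p \<in> tree"
    using \<open>p \<in> V\<close> \<open>openin T.mtopology V\<close> openin_subset by fastforce
  then obtain x s where xs: "x \<in> X" "0 \<le> s" "s \<le> r" "p = c x s"
    by (rule treeE)
  have "\<exists>C. connectedin T.mtopology C \<and> C \<subseteq> V \<and> p \<in> C \<and> q \<in> C" if q: "q \<in> T.mball p \<epsilon>" for q
  proof -
    have "q \<in> tree"
      using q by simp
    then obtain y t where yt: "y \<in> X" "0 \<le> t" "t \<le> r" "q = c y t"
      by (rule treeE)
    let ?m = "max (u x y) (max s t)"
    have m: "?m \<le> r"
      using xs yt u_le_r by simp
    have dist: "2 * ?m - s - t < \<epsilon>"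
      using q xs yt by (simp add: tdist_c)
    have "c x v \<in> T.mball p \<epsilon>" if "v \<in> {s..?m}" for v
    proof -
      have "tdist (c x s) (c x v) = v - s" "v \<le> ?m" "0 \<le> v" "v \<le> r"
        using that m xs by (auto simp: tdist_c)
      then show ?thesis
        using dist xs c_in_tree by simp
    qed
    moreover have "c y v \<in> T.mball p \<epsilon>" if "v \<in> {t..?m}" for v
    proof -
      have v: "0 \<le> v" "v \<le> r" "t \<le> v" "v \<le> ?m"
        using that m yt by auto
      have "tdist (c x s) (c y v) = 2 * max (u x y) (max s v) - s - v"
        using xs yt v by (simp add: tdist_c)
      then have "tdist (c x s) (c y v) \<le> 2 * ?m - s - t"
        using v by linarith
      then show ?thesis
        using dist xs yt v c_in_tree by simp
    qed
    ultimately have "c x ` {s..?m} \<union> c y ` {t..?m} \<subseteq> V"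
      using sub by blast
    moreover have "connectedin T.mtopology (c x ` {s..?m} \<union> c y ` {t..?m})"
      by (rule connectedin_path) (use xs yt m in auto)
    moreover have "p \<in> c x ` {s..?m}" "q \<in> c y ` {t..?m}"
      unfolding xs yt by (auto intro!: imageI)
    ultimately show ?thesis
      by blast
  qed
  then show "\<exists>U. openin T.mtopology U \<and> p \<in> U \<and> U \<subseteq> V \<and>
      (\<forall>q\<in>U. \<exists>C. connectedin T.mtopology C \<and> C \<subseteq> V \<and> p \<in> C \<and> q \<in> C)"
    using sub \<open>\<epsilon> > 0\<close> \<open>p \<in> tree\<close> by (intro exI[of _ "T.mball p \<epsilon>"]) auto
qed

section \<open>Cut points\<close>

text \<open>The strict bound on \<open>u x y\<close> selects, among the branches hanging down from
  \<open>c x s\<close>, only the one that contains the leaf \<open>c x 0\<close>.\<close>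

definition below :: "'a \<Rightarrow> real \<Rightarrow> 'b set" where
  "below x s = {c y t | y t. y \<in> X \<and> 0 \<le> t \<and> t < s \<and> u x y < s}"

lemma c_in_below_iff:
  assumes "x \<in> X" "s \<le> r" "y \<in> X" "0 \<le> t"
  shows "c y t \<in> below x s \<longleftrightarrow> t < s \<and> u x y < s"
proof
  assume "c y t \<in> below x s"
  then obtain z where z: "z \<in> X" "c y t = c z t" "t < s" "u x z < s"
    unfolding below_def using assms by (auto simp: c_eq_iff)
  then have "u z y \<le> t"
    using assms by (auto simp: c_eq_iff commute)
  then show "t < s \<and> u x y < s"
    using z assms ultra[of x z y] by auto
qed (use assms in \<open>auto simp: below_def\<close>)

lemma below_subset_tree: "s \<le> r \<Longrightarrow> below x s \<subseteq> tree"
  unfolding below_def by (auto intro: c_in_tree)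

text \<open>Every path leaving \<open>below x s\<close> passes through \<open>c x s\<close>.\<close>

lemma tdist_through_cut_point:
  assumes x: "x \<in> X" "0 < s" "s \<le> r" and p: "p \<in> below x s" and q: "q \<in> tree - below x s"
  shows "tdist p q = tdist p (c x s) + tdist (c x s) q"
proof -
  obtain y t where yt: "y \<in> X" "0 \<le> t" "t < s" "u x y < s" "p = c y t"
    using p unfolding below_def by blast
  obtain z v where zv: "z \<in> X" "0 \<le> v" "v \<le> r" "q = c z v"
    using q by (metis DiffD1 treeE)
  then have out: "s \<le> v \<or> s \<le> u x z"
    using q x c_in_below_iff[of x s z v] by auto
  \<comment> \<open>Since \<open>x\<close> and \<open>y\<close> merge below height \<open>s\<close>,
    while the path to \<open>q\<close> has to reach height \<open>s\<close>, \<open>y\<close> may be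
    replaced by \<open>x\<close> when the meeting height with \<open>z\<close> is computed.\<close>
  have "u x z \<le> max (u x y) (u y z)" "u y z \<le> max (u x y) (u x z)"
    using ultra[of x y z] ultra[of y x z] x yt zv commute by auto
  then have "max (u y z) (max t v) = max (u x z) (max s v)"
    using out yt by (auto simp: max_def split: if_splits)
  then show ?thesis
    using x yt zv by (simp add: tdist_c commute)
qed

text \<open>Both sides are open: as distances add up through the cut point, the ball around a point
  whose radius is the distance to the cut point cannot reach the other side.\<close>

lemma separatedin_cut_point:
  assumes x: "x \<in> X" "0 < s" "s \<le> r"
  shows "separatedin T.mtopology (below x s) (tree - {c x s} - below x s)"
proof -
  let ?p = "c x s" let ?B = "below x s"
  have p: "?p \<in> tree" "?p \<notin> ?B"
    using x c_in_tree c_in_below_iff[of x s x s] by auto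
  have sub: "?B \<subseteq> tree"
    using x below_subset_tree by blast
  have "openin T.mtopology ?B"
    unfolding T.openin_mtopology
  proof (intro conjI allI impI)
    fix q assume q: "q \<in> ?B"
    have "T.mball q (tdist q ?p) \<subseteq> ?B"
    proof
      fix q' assume q': "q' \<in> T.mball q (tdist q ?p)"
      show "q' \<in> ?B"
      proof (rule ccontr)
        assume "q' \<notin> ?B"
        then have "tdist q q' = tdist q ?p + tdist ?p q'"
          using q' by (intro tdist_through_cut_point x q) simp
        then show False
          using q' T.nonneg[of ?p q'] unfolding T.in_mball by linarith
      qed
    qed
    moreover have "tdist q ?p > 0"
      using q p sub by auto
    ultimately show "\<exists>e>0. T.mball q e \<subseteq> ?B"
      by blast
  qed (fact sub)
  moreover have "openin T.mtopology (tree - {?p} - ?B)"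
    unfolding T.openin_mtopology
  proof (intro conjI allI impI)
    fix q assume q: "q \<in> tree - {?p} - ?B"
    have "T.mball q (tdist q ?p) \<subseteq> tree - {?p} - ?B"
    proof
      fix q' assume q': "q' \<in> T.mball q (tdist q ?p)"
      have "q' \<notin> ?B"
      proof
        assume "q' \<in> ?B"
        then have "tdist q' q = tdist q' ?p + tdist ?p q"
          using q by (intro tdist_through_cut_point x) auto
        then show False
          using q' T.nonneg[of q' ?p] T.commute[of q q'] T.commute[of q ?p]
          unfolding T.in_mball by linarith
      qed
      then show "q' \<in> tree - {?p} - ?B"
        using q' by auto
    qed
    moreover have "tdist q ?p > 0"
      using q p by auto
    ultimately show "\<exists>e>0. T.mball q e \<subseteq> tree - {?p} - ?B"
      by blast
  qed auto
  ultimately show ?thesis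
    by (auto simp: separatedin_open_sets disjnt_def)
qed

text \<open>Serves both to show that inner points disconnect the tree and to find cut points inside
  arbitrary connected subsets.\<close>

lemma connectedin_cut_point:
  assumes x: "x \<in> X" "0 < s" "s \<le> r" and C: "connectedin T.mtopology C"
    and meets: "C \<inter> below x s \<noteq> {}" "\<not> C \<subseteq> below x s"
  shows "c x s \<in> C"
proof (rule ccontr)
  assume "c x s \<notin> C"
  moreover have "C \<subseteq> tree"
    using C connectedin_subset_topspace by fastforce
  ultimately have "C \<subseteq> below x s \<union> (tree - {c x s} - below x s)"
    by blast
  then show False
    using connectedin_subset_separated_union[OF C separatedin_cut_point[OF x]] meets by blast
qed

section \<open>Endpoints are the points of height 0\<close>

text \<open>The rest of the tree is a union of ascending branches that all end at the root. None of
  them meets the leaf, because a branch can have height 0 only at its start.\<close>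

lemma connectedin_remove_leaf:
  assumes x: "x \<in> X"
  shows "connectedin T.mtopology (tree - {c x 0})"
proof (cases "r = 0")
  case True
  have "tree \<subseteq> {c x 0}"
  proof
    fix p assume "p \<in> tree"
    then obtain y t where "y \<in> X" "0 \<le> t" "t \<le> r" "p = c y t"
      by (rule treeE)
    then show "p \<in> {c x 0}"
      using x True u_le_r[of y x] by (simp add: c_eq_iff)
  qed
  then show ?thesis
    by (metis Diff_eq_empty_iff connectedin_empty)
next
  case False
  \<comment> \<open>Branches may start at any height, so the branch above the removed leaf is
    covered by its parts starting at positive heights.\<close>
  define I where "I = {(y, t). y \<in> X \<and> 0 \<le> t \<and> t \<le> r \<and> c y t \<noteq> c x 0}"
  have avoid: "c x 0 \<notin> c y ` {t..r}" if "(y, t) \<in> I" for y t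
  proof
    assume "c x 0 \<in> c y ` {t..r}"
    then obtain v where v: "t \<le> v" "c x 0 = c y v"
      by auto
    then have "v = 0 \<and> t = 0"
      using that x by (auto simp: I_def c_eq_iff)
    then show False
      using that v by (auto simp: I_def)
  qed
  have root: "c y r = c x r" if "y \<in> X" for y
    using that x r_nonneg u_le_r by (simp add: c_eq_iff)
  have "tree - {c x 0} = (\<Union>(y, t)\<in>I. c y ` {t..r})"
  proof (intro equalityI subsetI)
    fix p assume "p \<in> tree - {c x 0}"
    then obtain y t where "(y, t) \<in> I" "p = c y t" "t \<le> r"
      by (auto simp: I_def elim!: treeE)
    then show "p \<in> (\<Union>(y, t)\<in>I. c y ` {t..r})"
      by force
  next
    fix p assume "p \<in> (\<Union>(y, t)\<in>I. c y ` {t..r})"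
    then obtain y t where yt: "(y, t) \<in> I" "p \<in> c y ` {t..r}"
      by auto
    then have "p \<noteq> c x 0"
      using avoid by blast
    moreover have "p \<in> tree"
      using yt by (auto simp: I_def intro!: c_in_tree)
    ultimately show "p \<in> tree - {c x 0}"
      by simp
  qed
  moreover have "connectedin T.mtopology (\<Union>(y, t)\<in>I. c y ` {t..r})"
  proof (rule connectedin_Union)
    show "connectedin T.mtopology S" if "S \<in> (\<lambda>(y, t). c y ` {t..r}) ` I" for S
      using that connectedin_branch by (auto simp: I_def)
    have "c x r \<in> c y ` {t..r}" if "(y, t) \<in> I" for y t
      using that root by (force simp: I_def)
    then show "\<Inter> ((\<lambda>(y, t). c y ` {t..r}) ` I) \<noteq> {}"
      by blast
  qed
  ultimately show ?thesis
    by simp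
qed

text \<open>The leaf \<open>c x 0\<close> lies below the removed point, whereas a leaf
  \<open>c y 0\<close> with \<open>u x y = r \<ge> s\<close> does not. This includes the root, where
  \<open>s = r\<close>.\<close>

lemma not_connectedin_remove_inner_point:
  assumes x: "x \<in> X" "0 < s" "s \<le> r"
  shows "\<not> connectedin T.mtopology (tree - {c x s})"
proof
  assume C: "connectedin T.mtopology (tree - {c x s})"
  obtain y where y: "y \<in> X" "u x y = r"
    using r_attained x by blast
  have "c x 0 \<in> tree - {c x s}" "c x 0 \<in> below x s"
    using x by (auto simp: c_eq_iff c_in_below_iff intro!: c_in_tree)
  moreover have "c y 0 \<in> tree - {c x s}" "c y 0 \<notin> below x s"
    using x y r_nonneg by (simp_all add: c_eq_iff c_in_below_iff c_in_tree)
  ultimately show False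
    using connectedin_cut_point[OF x C] by blast
qed

lemma connected_remove_point_iff:
  assumes "p \<in> tree"
  shows "connectedin T.mtopology (tree - {p}) \<longleftrightarrow> p \<in> (\<lambda>x. c x 0) ` X"
proof -
  obtain x s where xs: "x \<in> X" "0 \<le> s" "s \<le> r" "p = c x s"
    using assms by (rule treeE)
  show ?thesis
  proof (cases "s = 0")
    case True
    then show ?thesis
      using xs connectedin_remove_leaf by auto
  next
    case False
    then have "p \<notin> (\<lambda>x. c x 0) ` X"
      using xs by (auto simp: c_eq_iff)
    then show ?thesis
      using False xs not_connectedin_remove_inner_point by auto
  qed
qed

section \<open>Absence of circles\<close>

text \<open>A point strictly inside the ascending part of the path from \<open>p\<close> to
  \<open>q\<close> separates them, so it belongs to \<open>S\<close> and its removal disconnects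
  \<open>S\<close>.\<close>

lemma cut_point_between:
  assumes "connectedin T.mtopology S" "p \<in> S" "q \<in> S" "p \<noteq> q"
  obtains z where "z \<in> S" "\<not> connectedin T.mtopology (S - {z})"
proof -
  have sub: "S \<subseteq> tree"
    using assms(1) connectedin_subset_topspace by fastforce
  \<comment> \<open>With \<open>p\<close> the lower point, the path from \<open>p\<close> to
    \<open>q\<close> starts upwards, so there is room for a height \<open>h\<close> strictly between
    \<open>p\<close> and the meeting height.\<close>
  have *: "\<exists>z\<in>S. \<not> connectedin T.mtopology (S - {z})"
    if "p \<in> S" "q \<in> S" "p \<noteq> q" "height p \<le> height q" for p q
  proof -
    have "p \<in> tree" "q \<in> tree"
      using that sub by auto
    then obtain x s y t where xs: "x \<in> X" "0 \<le> s" "s \<le> r" "p = c x s"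
      and yt: "y \<in> X" "0 \<le> t" "t \<le> r" "q = c y t"
      by (metis treeE)
    let ?m = "max (u x y) t"
    have "s \<le> t" "s < ?m"
      using that(3,4) xs yt by (auto simp: c_eq_iff)
    then obtain h where h: "s < h" "h < ?m"
      using dense by blast
    then have xh: "x \<in> X" "0 < h" "h \<le> r"
      using xs yt u_le_r[of x y] by auto
    have p: "p \<in> below x h"
      using xs h xh by (simp add: c_in_below_iff)
    have q: "q \<notin> below x h"
      using yt h xh by (auto simp: c_in_below_iff)
    have ne: "c x h \<noteq> p" "c x h \<noteq> q"
      using h xh xs yt by (auto simp: c_eq_iff)
    have "c x h \<in> S"
      using connectedin_cut_point[OF xh assms(1)] p q that by blast
    moreover have "\<not> connectedin T.mtopology (S - {c x h})"
      using connectedin_cut_point[OF xh, of "S - {c x h}"] p q that ne by blast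
    ultimately show ?thesis
      by blast
  qed
  have "\<exists>z\<in>S. \<not> connectedin T.mtopology (S - {z})"
    using *[of p q] *[of q p] assms by (cases "height p \<le> height q") auto
  then show thesis
    using that by blast
qed

text \<open>A circle stays connected when any one point is removed, but a connected subset of the
  tree with two points has a cut point.\<close>

lemma no_circle_in_tree:
  "\<not> subtopology T.mtopology S homeomorphic_space top_of_set (sphere (0::complex) 1)"
  if "S \<subseteq> tree"
proof
  assume "subtopology T.mtopology S homeomorphic_space top_of_set (sphere (0::complex) 1)"
  then obtain f where
    f: "homeomorphic_map (subtopology T.mtopology S) (top_of_set (sphere (0::complex) 1)) f"
    by (metis homeomorphic_space)
  have top: "topspace (subtopology T.mtopology S) = S"
    using that by auto
  have im: "f ` S = sphere 0 1" and inj: "inj_on f S"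
    using homeomorphic_imp_surjective_map[OF f] homeomorphic_imp_injective_map[OF f]
    unfolding top by simp_all
  have conn: "connectedin T.mtopology U \<longleftrightarrow> connected (f ` U)" if "U \<subseteq> S" for U
    using homeomorphic_map_connectedness[OF f, of U] that image_mono[OF that, of f]
    unfolding top im by (simp add: connectedin_subtopology)
  have "1 \<in> f ` S" "-1 \<in> f ` S"
    by (auto simp: im)
  then obtain p q where "p \<in> S" "q \<in> S" "f p = 1" "f q = -1"
    unfolding image_iff by metis
  moreover have "p \<noteq> q"
    using \<open>f p = 1\<close> \<open>f q = -1\<close> by auto
  moreover have "connectedin T.mtopology S"
    using conn[of S] im connected_sphere[of "0::complex" 1] by simp
  ultimately obtain z where z: "z \<in> S" "\<not> connectedin T.mtopology (S - {z})"
    using cut_point_between by metis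
  have "f ` (S - {z}) = sphere 0 1 - {f z}"
    using inj im z by (auto simp: inj_on_image_set_diff[OF inj])
  moreover have "connected (sphere (0::complex) 1 - {f z})"
  proof -
    \<comment> \<open>This is stereographic projection; \<open>1\<close> serves as a nonzero normal
      vector, and the hyperplane is convex, hence connected.\<close>
    have "(sphere (0::complex) 1 - {f z}) homeomorphic {w::complex. 1 \<bullet> w = 0}"
      using z im by (intro homeomorphic_punctured_sphere_hyperplane) auto
    then show ?thesis
      using homeomorphic_connectedness convex_hyperplane convex_connected by blast
  qed
  ultimately show False
    using z conn[of "S - {z}"] by auto
qed

end

subsection \<open>Realization as an endpoint set\<close>

text \<open>An isometric copy of a compact space is compact, hence closed in the ambient metric
  space. This settles closedness both for the constructed dendrite and for an arbitrary one.\<close>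

lemma closedin_isometric_image:
  assumes "Metric_space X d" "compact_space (Metric_space.mtopology X d)"
    and "Metric_space Y \<rho>" "Z \<subseteq> Y" "isometric X d Z \<rho>"
  shows "closedin (Metric_space.mtopology Y \<rho>) Z"
proof -
  interpret D: Metric_space X d by fact
  interpret R: Metric_space Y \<rho> by fact
  obtain f where f: "bij_betw f X Z" and iso: "\<And>x x'. \<lbrakk>x \<in> X; x' \<in> X\<rbrakk> \<Longrightarrow> \<rho> (f x) (f x') = d x x'"
    using assms(5) unfolding isometric_def by blast
  have im: "f ` X = Z"
    using f by (simp add: bij_betw_def)
  have "continuous_map D.mtopology R.mtopology f"
    unfolding R.continuous_map_to_metric
  proof (intro ballI allI impI)
    fix x and \<epsilon> :: real assume "x \<in> topspace D.mtopology" "\<epsilon> > 0"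
    moreover have "f y \<in> R.mball (f x) \<epsilon>" if "y \<in> D.mball x \<epsilon>" for y
      using that im iso assms(4) by auto
    ultimately show "\<exists>U. openin D.mtopology U \<and> x \<in> U \<and> (\<forall>y\<in>U. f y \<in> R.mball (f x) \<epsilon>)"
      by (intro exI[of _ "D.mball x \<epsilon>"]) auto
  qed
  then have "compactin R.mtopology Z"
    using image_compactin[of D.mtopology X] assms(2) im by (metis D.topspace_mtopology compact_space_def)
  then show ?thesis
    using compactin_imp_closedin R.Hausdorff_space_mtopology by blast
qed

theorem theoremA:
  fixes X :: "'a set" and d :: "'a \<Rightarrow> 'a \<Rightarrow> real"
  assumes "Metric_space X d"
    and "compact_space (Metric_space.mtopology X d)"
    and "totally_disconnected_space (Metric_space.mtopology X d)"
  shows "(\<exists>(Y :: real set) \<rho>.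
            dendrite Y \<rho> \<and> isometric X d (endpoints Y \<rho>) \<rho> \<and>
            closedin (Metric_space.mtopology Y \<rho>) (endpoints Y \<rho>)) \<and>
         (\<forall>(Y :: 'b set) \<rho>.
            dendrite Y \<rho> \<and> isometric X d (endpoints Y \<rho>) \<rho> \<longrightarrow>
            closedin (Metric_space.mtopology Y \<rho>) (endpoints Y \<rho>))"
proof
  show "\<forall>(Y :: 'b set) \<rho>. dendrite Y \<rho> \<and> isometric X d (endpoints Y \<rho>) \<rho> \<longrightarrow>
      closedin (Metric_space.mtopology Y \<rho>) (endpoints Y \<rho>)"
    using assms(1,2)
    by (auto intro!: closedin_isometric_image simp: dendrite_def continuum_def endpoints_def)
  obtain u :: "'a \<Rightarrow> 'a \<Rightarrow> real" and c :: "'a \<Rightarrow> real \<Rightarrow> real" and r :: real where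
    u: "Metric_space X u"
    "\<And>x y z. \<lbrakk>x \<in> X; y \<in> X; z \<in> X\<rbrakk> \<Longrightarrow> u x z \<le> max (u x y) (u y z)"
    "\<And>x y. \<lbrakk>x \<in> X; y \<in> X\<rbrakk> \<Longrightarrow> d x y \<le> u x y"
    "compact_space (Metric_space.mtopology X u)"
    and r: "r \<ge> 0" "\<And>x y. \<lbrakk>x \<in> X; y \<in> X\<rbrakk> \<Longrightarrow> u x y \<le> r" "\<And>x. x \<in> X \<Longrightarrow> \<exists>y\<in>X. u x y = r"
    and c: "\<And>x y s t. \<lbrakk>x \<in> X; y \<in> X; s \<ge> 0; t \<ge> 0\<rbrakk> \<Longrightarrow> c x s = c y t \<longleftrightarrow> s = t \<and> u x y \<le> t"
    by (rule Metric_space.dominating_ultrametric[OF assms]) blast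
  interpret ultrametric_tree X u r c
    by (intro ultrametric_tree.intro ultrametric_tree_axioms.intro u r c)
  let ?e = "\<lambda>x. c x 0"
  obtain \<rho> where \<rho>: "Metric_space tree \<rho>"
    and \<rho>_le: "\<And>p q. \<lbrakk>p \<in> tree; q \<in> tree\<rbrakk> \<Longrightarrow> \<rho> p q \<le> tdist p q"
    and \<rho>_eq: "\<And>x y. \<lbrakk>x \<in> X; y \<in> X\<rbrakk> \<Longrightarrow> \<rho> (?e x) (?e y) = d x y"
  proof (rule extend_smaller_metric[OF T.Metric_space_axioms assms(1), of ?e])
    show "?e \<in> X \<rightarrow> tree"
      using r_nonneg by (auto intro: c_in_tree)
    show "d x y \<le> tdist (?e x) (?e y)" if "x \<in> X" "y \<in> X" for x y
      using u(3)[OF that] nonneg[of x y] that r_nonneg by (simp add: tdist_c del: nonneg)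
    \<comment> \<open>The height of \<open>p\<close> serves as \<open>\<delta>\<close>, because
      leaves have height 0.\<close>
    show "\<exists>\<delta>>0. \<forall>x\<in>X. \<delta> \<le> tdist p (?e x)" if p: "p \<in> tree - ?e ` X" for p
    proof -
      obtain y t where yt: "y \<in> X" "0 \<le> t" "t \<le> r" "p = c y t"
        using p by (metis DiffD1 treeE)
      then have "t > 0"
        using p by (cases "t = 0") auto
      moreover have "t \<le> tdist p (?e x)" if "x \<in> X" for x
        using tdist_ge_height[of p "?e x"] that yt p r_nonneg by (simp add: c_in_tree)
      ultimately show ?thesis
        by blast
    qed
  qed blast
  interpret R: Metric_space tree \<rho> by (fact \<rho>)
  \<comment> \<open>Apart from being a metric, the dendrite conditions and the endpoint set depend
    only on the topology, so what was proved for \<open>tdist\<close> carries over to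
    \<open>\<rho>\<close>.\<close>
  have top: "R.mtopology = T.mtopology"
    by (rule Metric_space_mtopology_eqI[OF T.Metric_space_axioms \<rho> compact_tree \<rho>_le])
  have dendrite: "dendrite tree \<rho>"
    unfolding dendrite_def continuum_def top
    using \<rho> compact_tree connected_tree locally_connected_tree no_circle_in_tree by blast
  have "endpoints tree \<rho> = ?e ` X"
    using connected_remove_point_iff r_nonneg unfolding endpoints_def top by (auto intro: c_in_tree)
  moreover have "inj_on ?e X"
  proof (rule inj_onI)
    fix x y assume "x \<in> X" "y \<in> X" "?e x = ?e y"
    then show "x = y"
      using nonneg[of x y] by (simp add: c_eq_iff del: nonneg)
  qed
  ultimately have "isometric X d (endpoints tree \<rho>) \<rho>"
    unfolding isometric_def bij_betw_def using \<rho>_eq by metis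
  moreover from this have "closedin R.mtopology (endpoints tree \<rho>)"
    using assms(1,2) R.Metric_space_axioms
    by (intro closedin_isometric_image) (auto simp: endpoints_def)
  ultimately show "\<exists>(Y :: real set) \<rho>. dendrite Y \<rho> \<and> isometric X d (endpoints Y \<rho>) \<rho> \<and>
      closedin (Metric_space.mtopology Y \<rho>) (endpoints Y \<rho>)"
    using dendrite by blast
qed

end
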